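(* Let $K$ be a field of characteristic zero and let $\mathcal{A}$ be a $K$-algebra such that every $K$-subalgebra of $\mathcal{A}$ generated by finitely many elements of $\mathcal{A}$ is finite dimensional over $K$. Let $\delta$ be a $K$-derivation or a $K$-$\mathcal{E}$-derivation of $\mathcal{A}$. Then: 1) If $\delta$ is locally nilpotent, then $\delta$ maps every $K$-subspace of $\mathcal{A}$ to a Mathieu subspace of $\mathcal{A}$. In particular, every locally nilpotent $K$-derivation and every locally nilpotent $K$-$\mathcal{E}$-derivation of $\mathcal{A}$ maps every $\vartheta$-ideal of $\mathcal{A}$ to a $\vartheta$-Mathieu subspace of $\mathcal{A}$, for each $\vartheta\in\{\text{left},\text{right},\text{two-sided}\}$. 2) If $\delta$ is locally finite and either $\delta$ is a $K$-derivation of $\mathcal{A}$, or $\delta=\mathrm{I}-\phi$ for some $K$-algebra automorphism $\phi$ of $\mathcal{A}$, then the image $\operatorname{Im}\delta=\delta(\mathcal{A})$ is a Mathieu subspace of $\mathcal{A}$.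
   Context: Algebras are associative, not necessarily commutative. $\mathrm{I}$ denotes the identity map of $\mathcal{A}$. $K$-algebra endomorphisms are $K$-linear multiplicative maps (not required to preserve an identity element). A $K$-linear endomorphism $\eta$ of $\mathcal{A}$ is locally nilpotent if for each $a\in\mathcal{A}$ there is $m\ge1$ with $\eta^m(a)=0$, and locally finite if for each $a\in\mathcal{A}$ the $K$-subspace spanned by $\eta^i(a)$ $(i\ge 0)$ is finite dimensional. A $K$-derivation of $\mathcal{A}$ is a $K$-linear map $D:\mathcal{A}\to\mathcal{A}$ with $D(ab)=D(a)b+aD(b)$ for all $a,b$. A $K$-$\mathcal{E}$-derivation of $\mathcal{A}$ is a $K$-linear map $\delta:\mathcal{A}\to\mathcal{A}$ with $\delta(ab)=\delta(a)b+a\delta(b)-\delta(a)\delta(b)$ for all $a,b$; equivalently, $\delta=\mathrm{I}-\phi$ for some $K$-algebra endomorphism $\phi$ of $\mathcal{A}$. A $K$-subspace $V$ of $\mathcal{A}$ is a $\vartheta$-Mathieu subspace of $\mathcal{A}$ if for all $a,b,c\in\mathcal{A}$ with $a^m\in V$ for all $m\ge1$: (left) $ba^m\in V$ for all sufficiently large $m$, if $\vartheta=$ left; (right) $a^mc\in V$ for all sufficiently large $m$, if $\vartheta=$ right; (two-sided) $ba^mc\in V$ for all sufficiently large $m$, if $\vartheta=$ two-sided. A "Mathieu subspace" means a two-sided Mathieu subspace. *)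

theory Defs
  imports Complex_Main
begin

(* Associative algebras over a field. The class ring has neither a unit nor
   commutativity, so algebras with and without identity are both covered. *)
locale assoc_algebra = vector_space scale
  for scale :: "'k::field \<Rightarrow> 'a::ring \<Rightarrow> 'a" +
  assumes scale_mult_left: "scale k x * y = scale k (x * y)"
    and scale_mult_right: "x * scale k y = scale k (x * y)"

(* Powers a^m for m \<ge> 1; there need be no a^0, and the value at m = 0 is junk. *)
definition pos_power :: "'a::ring \<Rightarrow> nat \<Rightarrow> 'a" where
  "pos_power a m = (((*) a) ^^ (m - 1)) a"

definition subalgebra :: "('k::field \<Rightarrow> 'a::ring \<Rightarrow> 'a) \<Rightarrow> 'a set \<Rightarrow> bool" where
  "subalgebra scale B \<longleftrightarrow> module.subspace scale B \<and> (\<forall>x\<in>B. \<forall>y\<in>B. x * y \<in> B)"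

definition finite_dim :: "('k::field \<Rightarrow> 'a::ring \<Rightarrow> 'a) \<Rightarrow> 'a set \<Rightarrow> bool" where
  "finite_dim scale V \<longleftrightarrow> (\<exists>S. finite S \<and> V = module.span scale S)"

definition algebra_endomorphism :: "('k::field \<Rightarrow> 'a::ring \<Rightarrow> 'a) \<Rightarrow> ('a \<Rightarrow> 'a) \<Rightarrow> bool" where
  "algebra_endomorphism scale \<phi> \<longleftrightarrow>
     Vector_Spaces.linear scale scale \<phi> \<and> (\<forall>a b. \<phi> (a * b) = \<phi> a * \<phi> b)"

definition algebra_automorphism :: "('k::field \<Rightarrow> 'a::ring \<Rightarrow> 'a) \<Rightarrow> ('a \<Rightarrow> 'a) \<Rightarrow> bool" where
  "algebra_automorphism scale \<phi> \<longleftrightarrow> algebra_endomorphism scale \<phi> \<and> bij \<phi>"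

definition derivation :: "('k::field \<Rightarrow> 'a::ring \<Rightarrow> 'a) \<Rightarrow> ('a \<Rightarrow> 'a) \<Rightarrow> bool" where
  "derivation scale D \<longleftrightarrow>
     Vector_Spaces.linear scale scale D \<and> (\<forall>a b. D (a * b) = D a * b + a * D b)"

definition E_derivation :: "('k::field \<Rightarrow> 'a::ring \<Rightarrow> 'a) \<Rightarrow> ('a \<Rightarrow> 'a) \<Rightarrow> bool" where
  "E_derivation scale \<delta> \<longleftrightarrow>
     Vector_Spaces.linear scale scale \<delta> \<and>
     (\<forall>a b. \<delta> (a * b) = \<delta> a * b + a * \<delta> b - \<delta> a * \<delta> b)"

definition locally_nilpotent :: "('a::ring \<Rightarrow> 'a) \<Rightarrow> bool" where
  "locally_nilpotent \<eta> \<longleftrightarrow> (\<forall>a. \<exists>m\<ge>1. (\<eta> ^^ m) a = 0)"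

definition locally_finite :: "('k::field \<Rightarrow> 'a::ring \<Rightarrow> 'a) \<Rightarrow> ('a \<Rightarrow> 'a) \<Rightarrow> bool" where
  "locally_finite scale \<eta> \<longleftrightarrow>
     (\<forall>a. finite_dim scale (module.span scale (range (\<lambda>i. (\<eta> ^^ i) a))))"

datatype side = Left | Right | Two_Sided

(* Ideals of an algebra are linear subspaces; without an identity element this
   does not follow from closure under addition and outer multiplication. *)
definition sided_ideal :: "('k::field \<Rightarrow> 'a::ring \<Rightarrow> 'a) \<Rightarrow> side \<Rightarrow> 'a set \<Rightarrow> bool" where
  "sided_ideal scale \<theta> J \<longleftrightarrow> module.subspace scale J \<and>
     (case \<theta> of
        Left \<Rightarrow> \<forall>b. \<forall>x\<in>J. b * x \<in> J
      | Right \<Rightarrow> \<forall>c. \<forall>x\<in>J. x * c \<in> J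
      | Two_Sided \<Rightarrow> (\<forall>b. \<forall>x\<in>J. b * x \<in> J) \<and> (\<forall>c. \<forall>x\<in>J. x * c \<in> J))"

definition mathieu_subspace :: "('k::field \<Rightarrow> 'a::ring \<Rightarrow> 'a) \<Rightarrow> side \<Rightarrow> 'a set \<Rightarrow> bool" where
  "mathieu_subspace scale \<theta> V \<longleftrightarrow> module.subspace scale V \<and>
     (\<forall>a b c. (\<forall>m\<ge>1. pos_power a m \<in> V) \<longrightarrow>
        (case \<theta> of
           Left \<Rightarrow> \<forall>\<^sub>F m in sequentially. b * pos_power a m \<in> V
         | Right \<Rightarrow> \<forall>\<^sub>F m in sequentially. pos_power a m * c \<in> V
         | Two_Sided \<Rightarrow> \<forall>\<^sub>F m in sequentially. b * pos_power a m * c \<in> V))"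

lemma pos_power_simps:
  "pos_power a (Suc 0) = a"
  "m \<ge> 1 \<Longrightarrow> pos_power a (Suc m) = a * pos_power a m"
  by (cases m; simp add: pos_power_def)+

lemma (in assoc_algebra) E_derivation_iff:
  "E_derivation scale \<delta> \<longleftrightarrow>
     (\<exists>\<phi>. algebra_endomorphism scale \<phi> \<and> \<delta> = (\<lambda>x. x - \<phi> x))"
proof
  interpret vector_space_pair scale scale by unfold_locales
  note lin_id = linear_id[unfolded id_def]
  show "\<exists>\<phi>. algebra_endomorphism scale \<phi> \<and> \<delta> = (\<lambda>x. x - \<phi> x)" if "E_derivation scale \<delta>"
    using that linear_compose_sub[OF lin_id, of \<delta>]
    unfolding E_derivation_def algebra_endomorphism_def
    by (intro exI[of _ "\<lambda>x. x - \<delta> x"]) (auto simp: algebra_simps)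
  show "E_derivation scale \<delta>" if "\<exists>\<phi>. algebra_endomorphism scale \<phi> \<and> \<delta> = (\<lambda>x. x - \<phi> x)"
    using that linear_compose_sub[OF lin_id]
    unfolding E_derivation_def algebra_endomorphism_def by (auto simp: algebra_simps)
qed

end

theory Submission
  imports Defs
begin

text \<open>Under the assumptions of either part, the image of \<open>\<delta>\<close> contains no nonzero idempotent;
  everything else follows from this.

  Let \<open>e\<close> be an idempotent in the image, say the image of \<open>a\<close>. Since \<open>\<delta>\<close> is locally finite
  (local nilpotence is a special case), \<open>a\<close> lies in a finite-dimensional \<open>\<delta>\<close>-stable
  subalgebra \<open>B\<close>. Write \<open>L x\<close> for left multiplication by \<open>x\<close> on \<open>B\<close>. If \<open>\<delta>\<close> is a derivation,
  then \<open>L e\<close> is the commutator of \<open>\<delta>\<close> and \<open>L a\<close>. If \<open>\<delta> = I - \<phi>\<close> with \<open>\<phi>\<close> injective, then \<open>\<phi>\<close>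
  is bijective on \<open>B\<close> and \<open>L e = L a - \<phi> (L a) \<phi>\<inverse>\<close>. Either way \<open>L e\<close> has trace zero. But
  \<open>L e\<close> is a projection, whose trace is its rank, so in characteristic zero \<open>e * B = 0\<close>
  and \<open>e = e * e = 0\<close>. Injectivity of \<open>\<phi>\<close> is clear for an automorphism, and it follows from
  local nilpotence of \<open>I - \<phi>\<close>.

  On the other hand, if all powers of \<open>a\<close> lie in a subspace \<open>V\<close>, then, \<open>a\<close> being algebraic,
  either \<open>a\<close> is nilpotent or a nonzero idempotent is a linear combination of powers of
  \<open>a\<close>, and hence lies in \<open>V\<close>. So a subspace without nonzero idempotents is a Mathieu
  subspace of every kind, for the strong reason that \<open>a\<^sup>m = 0\<close> for large \<open>m\<close>. This applies
  to the image under \<open>\<delta>\<close> of every subspace.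

  The two halves are \<open>derivation_image_no_idempotents\<close> with
  \<open>E_derivation_image_no_idempotents\<close>, and \<open>mathieu_if_no_idempotents\<close>.\<close>

section \<open>Finite bases and traces\<close>

context vector_space
begin

text \<open>Defined by the diagonal entries of the matrix in the basis \<open>B\<close>, for maps of the whole
  space that need only send \<open>B\<close> into its span. The prefix \<open>local\<close> below tells the
  constant apart from its instance for real vector spaces.\<close>

definition trace_on :: "'b set \<Rightarrow> ('b \<Rightarrow> 'b) \<Rightarrow> 'a" where
  "trace_on B f = (\<Sum>b\<in>B. representation B (f b) b)"

lemma trace_on_diff:
  assumes "independent B" "f ` B \<subseteq> span B" "g ` B \<subseteq> span B"
  shows "local.trace_on B (\<lambda>x. f x - g x) = local.trace_on B f - local.trace_on B g"
proof -
  have "representation B (f b - g b) b = representation B (f b) b - representation B (g b) b"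
    if "b \<in> B" for b
    using representation_diff[OF assms(1), of "g b" "f b"] assms(2,3) that
    by (simp add: image_subset_iff)
  then show ?thesis
    by (simp add: local.trace_on_def sum_subtractf)
qed

text \<open>The double sum is symmetric in \<open>f\<close> and \<open>g\<close> up to exchanging \<open>b\<close> and \<open>c\<close>, which gives
  the commutation of the trace.\<close>

lemma trace_on_comp:
  assumes B: "independent B" "finite B"
    and f: "f ` B \<subseteq> span B" and g: "Vector_Spaces.linear scale scale g" "g ` B \<subseteq> span B"
  shows "local.trace_on B (\<lambda>x. g (f x)) =
    (\<Sum>b\<in>B. \<Sum>c\<in>B. representation B (f b) c * representation B (g c) b)"
  unfolding local.trace_on_def
proof (rule sum.cong[OF refl])
  fix b assume b: "b \<in> B"
  interpret g: Vector_Spaces.linear scale scale g by (fact g(1))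
  let ?r = "representation B"
  have span_g: "g c \<in> span B" if "c \<in> B" for c
    using g(2) that by auto
  have "f b = (\<Sum>c\<in>B. ?r (f b) c *s c)"
    using sum_representation_eq[OF B(1) _ B(2) order_refl, of "f b"] f b by auto
  then have "g (f b) = (\<Sum>c\<in>B. ?r (f b) c *s g c)"
    by (metis (no_types, lifting) g.sum g.scale sum.cong)
  then show "?r (g (f b)) b = (\<Sum>c\<in>B. ?r (f b) c * ?r (g c) b)"
    using span_g
    by (simp add: representation_sum[OF B(1)] representation_scale[OF B(1)] span_scale)
qed

lemma trace_on_commute:
  assumes "independent B" "finite B"
    and "Vector_Spaces.linear scale scale f" "f ` B \<subseteq> span B"
    and "Vector_Spaces.linear scale scale g" "g ` B \<subseteq> span B"
  shows "local.trace_on B (\<lambda>x. g (f x)) = local.trace_on B (\<lambda>x. f (g x))"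
proof -
  have "local.trace_on B (\<lambda>x. g (f x)) =
    (\<Sum>c\<in>B. \<Sum>b\<in>B. representation B (f b) c * representation B (g c) b)"
    using local.trace_on_comp[of B f g] assms by (subst sum.swap) auto
  also have "\<dots> = local.trace_on B (\<lambda>x. f (g x))"
    using local.trace_on_comp[of B g f] assms by (simp add: mult.commute)
  finally show ?thesis .
qed

text \<open>The trace of a projection is its rank: extend a basis \<open>C\<close> of the range to
  a basis \<open>B\<close>. A vector of \<open>B\<close> outside \<open>C\<close> is sent into the span of \<open>C\<close> and so
  contributes nothing to the trace, and each vector of \<open>C\<close> contributes one.\<close>

lemma trace_on_projection:
  assumes B: "independent B" "finite B" and C: "C \<subseteq> B"
    and fixed: "\<And>c. c \<in> C \<Longrightarrow> p c = c" and range: "p ` B \<subseteq> span C"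
  shows "local.trace_on B p = of_nat (card C)"
proof -
  have indC: "independent C"
    using B(1) C independent_mono by blast
  have "representation B (p b) b = 0" if "b \<in> B - C" for b
  proof -
    have "representation B (p b) = representation C (p b)"
      using representation_extend[OF B(1) _ C] range that by auto
    then show ?thesis
      using representation_ne_zero[of C "p b" b] that by auto
  qed
  moreover have "representation B (p c) c = 1" if "c \<in> C" for c
    using fixed[OF that] representation_basis[OF B(1), of c] C that by auto
  ultimately have "local.trace_on B p = (\<Sum>c\<in>C. 1)"
    unfolding local.trace_on_def using B(2) C by (intro sum.mono_neutral_cong_right) auto
  then show ?thesis
    by simp
qed

text \<open>The set \<open>f ` B\<close> is independent and has as many elements as \<open>B\<close>. Adding to it a vector of
  \<open>B\<close> outside its span would give an independent set that is too large for \<open>span B\<close>.\<close>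

lemma injective_image_span_eq:
  assumes B: "independent B" "finite B"
    and f: "Vector_Spaces.linear scale scale f" "inj f" "f ` B \<subseteq> span B"
  shows "f ` span B = span B"
proof -
  interpret f: Vector_Spaces.linear scale scale f by (fact f(1))
  have ind: "independent (f ` B)"
    using f.independent_inj_image[OF B(1) f(2)] .
  have card: "card (f ` B) = card B"
    using f(2) by (simp add: card_image inj_on_subset)
  have "b \<in> span (f ` B)" if "b \<in> B" for b
  proof (rule ccontr)
    assume b: "b \<notin> span (f ` B)"
    then have "b \<notin> f ` B"
      using span_base by blast
    moreover have "independent (insert b (f ` B))"
      using ind b by (rule independent_insertI[rotated])
    then have "card (insert b (f ` B)) \<le> card B"
      using independent_span_bound[OF B(2)] f(3) span_base[OF that] by blast
    ultimately show False
      using card B(2) by simp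
  qed
  then have "span B \<subseteq> span (f ` B)"
    by (simp add: span_minimal subsetI)
  moreover have "span (f ` B) \<subseteq> span B"
    using f(3) by (simp add: span_minimal)
  ultimately show ?thesis
    by (simp add: f.span_image)
qed

lemma basis_between:
  assumes "independent C" "C \<subseteq> V" "subspace V" "V \<subseteq> span S" "finite S"
  obtains B where "C \<subseteq> B" "independent B" "finite B" "span B = V"
proof -
  obtain B where B: "C \<subseteq> B" "B \<subseteq> V" "independent B" "V \<subseteq> span B"
    using maximal_independent_subset_extend[OF assms(2,1)] by blast
  moreover have "finite B"
    using independent_span_bound[OF assms(5) B(3)] B(2) assms(4) by blast
  moreover have "span B = V"
    using B assms(3) by (simp add: span_minimal subset_antisym)
  ultimately show ?thesis
    using that by blast
qed

text \<open>If no term lies in the span of the later ones, then any finite run of terms is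
  independent: build it up from its last term.\<close>

lemma term_in_span_of_later_terms:
  fixes f :: "nat \<Rightarrow> 'b"
  assumes "finite S" "range f \<subseteq> span S"
  obtains n where "f n \<in> span (f ` {n<..})"
proof (rule ccontr)
  assume "\<not> thesis"
  then have new: "f n \<notin> span (f ` {n<..})" for n
    using that by blast
  have "independent (f ` {i..<i+k}) \<and> card (f ` {i..<i+k}) = k" for i k
  proof (induction k arbitrary: i)
    case 0
    then show ?case by (simp add: independent_empty)
  next
    case (Suc k)
    have split: "{i..<i + Suc k} = insert i {Suc i..<Suc i + k}"
      by auto
    have "f ` {Suc i..<Suc i + k} \<subseteq> f ` {i<..}"
      by auto
    then have notin: "f i \<notin> span (f ` {Suc i..<Suc i + k})"
      using new span_mono by blast
    then have "f i \<notin> f ` {Suc i..<Suc i + k}"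
      using span_base by blast
    then show ?case
      using Suc[of "Suc i"] notin unfolding split image_insert
      by (simp add: independent_insert)
  qed
  from this[of 0 "Suc (card S)"] have "Suc (card S) \<le> card S"
    using independent_span_bound[OF assms(1), of "f ` {0..<0 + Suc (card S)}"] assms(2)
    by (metis image_subset_iff range_subsetD)
  then show False
    by simp
qed

end

section \<open>Nilpotency and idempotents in algebraic algebras\<close>

declare pos_power_simps(1) [simp]

lemma pos_power_add:
  assumes "m \<ge> 1" "n \<ge> 1"
  shows "pos_power a (m + n) = pos_power a m * pos_power a n"
  using assms(1)
proof (induction m rule: dec_induct)
  case base
  then show ?case using pos_power_simps(2)[OF assms(2)] by simp
next
  case (step m)
  then show ?case
    using pos_power_simps(2)[of m a] pos_power_simps(2)[of "m + n" a] by (simp add: mult.assoc)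
qed

context assoc_algebra
begin

lemma linear_mult_left: "Vector_Spaces.linear scale scale ((*) a)"
  by unfold_locales (simp_all add: distrib_left scale_mult_right)

lemma linear_mult_right: "Vector_Spaces.linear scale scale (\<lambda>x. x * a)"
  by unfold_locales (simp_all add: distrib_right scale_mult_left)

lemma subalgebra_hull: "subalgebra scale (subalgebra scale hull S)"
  by (rule hull_in) (auto simp: subalgebra_def intro: subspace_Inter)

lemma pos_power_in_subalgebra:
  assumes "subalgebra scale B" "a \<in> B" "m \<ge> 1"
  shows "pos_power a m \<in> B"
  using assms(3)
proof (induction m rule: dec_induct)
  case (step m)
  then show ?case using assms pos_power_simps(2)[of m a] by (simp add: subalgebra_def)
qed (use assms in simp)

text \<open>Write \<open>R k\<close> for the span of the powers \<open>a\<^sup>m\<close> with \<open>m \<ge> k\<close>. A linear relation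
  between the powers of \<open>a\<close> puts some \<open>a\<^sup>n\<close> into \<open>R (n + 1)\<close>; then multiplication by
  \<open>a\<close> shows \<open>R k = R (k + 1)\<close> for all \<open>k \<ge> n\<close>. In particular \<open>a\<^sup>n\<close> lies in \<open>R (2 * n)\<close>,
  which is \<open>a\<^sup>n * R n\<close>, so \<open>a\<^sup>n = a\<^sup>n * u\<close> with \<open>u\<close> in \<open>R n\<close>. Hence \<open>u\<close> acts as an
  identity on \<open>R n\<close>; it is idempotent, and it vanishes only if \<open>a\<^sup>n\<close> does.\<close>

lemma nilpotent_if_powers_avoid_idempotents:
  assumes V: "subspace V" "\<And>m. m \<ge> 1 \<Longrightarrow> pos_power a m \<in> V"
    and alg: "finite S" "\<And>m. m \<ge> 1 \<Longrightarrow> pos_power a m \<in> span S"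
    and idem: "\<And>e. e \<in> V \<Longrightarrow> e * e = e \<Longrightarrow> e = 0"
  shows "\<forall>\<^sub>F m in sequentially. pos_power a m = 0"
proof -
  define R where "R k = span (pos_power a ` {k..})" for k
  have R_subspace: "subspace (R k)" for k
    by (simp add: R_def)
  have mult_R: "pos_power a k * x \<in> R (k + j)" if "x \<in> R j" "k \<ge> 1" "j \<ge> 1" for k j x
    using that(1) unfolding R_def
  proof (induction rule: span_induct)
    case base
    interpret L: Vector_Spaces.linear scale scale "(*) (pos_power a k)"
      by (rule linear_mult_left)
    show ?case
      using L.subspace_vimage[OF R_subspace] by (simp add: R_def vimage_def)
  next
    case (step x)
    then obtain m where "m \<ge> j" "x = pos_power a m"
      by auto
    then show ?case
      using pos_power_add[of k m a] that by (auto intro!: span_base image_eqI[of _ _ "k + m"])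
  qed
  have "range (\<lambda>j. pos_power a (Suc j)) \<subseteq> span S"
    using alg(2) by auto
  then obtain i where i: "pos_power a (Suc i) \<in> span ((\<lambda>j. pos_power a (Suc j)) ` {i<..})"
    using term_in_span_of_later_terms[OF alg(1)] by blast
  define n where "n = Suc i"
  have n: "n \<ge> 1"
    by (simp add: n_def)
  have "(\<lambda>j. pos_power a (Suc j)) ` {i<..} \<subseteq> pos_power a ` {Suc n..}"
    by (auto simp: n_def)
  then have start: "pos_power a n \<in> R (Suc n)"
    using i span_mono[of "(\<lambda>j. pos_power a (Suc j)) ` {i<..}" "pos_power a ` {Suc n..}"]
    unfolding R_def n_def by blast
  have step: "pos_power a m \<in> R (Suc m)" if "m \<ge> n" for m
    using that
  proof (induction m rule: dec_induct)
    case (step m)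
    then show ?case
      using mult_R[of _ "Suc m" 1] pos_power_simps(2)[of m a] n by simp
  qed (fact start)
  have R_Suc: "R m \<subseteq> R (Suc m)" if "m \<ge> n" for m
  proof -
    have "pos_power a k \<in> R (Suc m)" if "k \<ge> m" for k
      using that step[OF \<open>m \<ge> n\<close>] by (cases "k = m") (auto simp: R_def intro: span_base)
    then have "pos_power a ` {m..} \<subseteq> R (Suc m)"
      by auto
    then show ?thesis
      by (subst R_def) (rule span_minimal[OF _ R_subspace])
  qed
  have "pos_power a n \<in> R m" if "m \<ge> n" for m
    using that
  proof (induction m rule: dec_induct)
    case base
    then show ?case by (auto simp: R_def intro: span_base)
  qed (use R_Suc in blast)
  then have "pos_power a n \<in> R (n + n)"
    by simp
  moreover have "R (n + n) \<subseteq> (*) (pos_power a n) ` R n"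
  proof -
    interpret L: Vector_Spaces.linear scale scale "(*) (pos_power a n)"
      by (rule linear_mult_left)
    have "pos_power a m \<in> (*) (pos_power a n) ` R n" if "m \<ge> n + n" for m
      using that pos_power_add[of n "m - n" a] n
      by (intro image_eqI[of _ _ "pos_power a (m - n)"]) (auto simp: R_def intro: span_base)
    then show ?thesis
      unfolding R_def[of "n + n"]
      by (intro span_minimal) (auto intro: L.subspace_image R_subspace)
  qed
  ultimately obtain u where u: "u \<in> R n" "pos_power a n = pos_power a n * u"
    by blast
  have absorb: "pos_power a m * u = pos_power a m" if "m \<ge> n" for m
  proof (cases "m = n")
    case False
    then have "pos_power a m = pos_power a (m - n) * pos_power a n"
      using that n pos_power_add[of "m - n" n a] by simp
    then show ?thesis
      using u(2) by (simp add: mult.assoc)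
  qed (use u in simp)
  have "x * u = x" if "x \<in> R n" for x
    using that unfolding R_def
  proof (induction rule: span_induct)
    case base
    interpret L: Vector_Spaces.linear scale scale "\<lambda>x. x * u"
      by (rule linear_mult_right)
    show ?case
      by (auto simp: subspace_def L.add L.scale)
  qed (use absorb in auto)
  then have "u * u = u"
    using u(1) by blast
  moreover have "R n \<subseteq> V"
    unfolding R_def using V n by (intro span_minimal) auto
  ultimately have "u = 0"
    using idem u(1) by blast
  then have "pos_power a m = 0" if "m \<ge> n" for m
    using absorb[OF that] by simp
  then show ?thesis
    unfolding eventually_sequentially by blast
qed

end

locale algebra_with_finite_dim_subalgebras = assoc_algebra scale
  for scale :: "'k::field_char_0 \<Rightarrow> 'a::ring \<Rightarrow> 'a" +
  assumes finitely_generated_finite_dim: "finite S \<Longrightarrow> finite_dim scale (subalgebra scale hull S)"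
begin

text \<open>Under the hypotheses all conditions in the definition are met because \<open>a\<^sup>m\<close>
  itself vanishes for large \<open>m\<close>.\<close>

lemma mathieu_if_no_idempotents:
  assumes V: "subspace V" and idem: "\<And>e. e \<in> V \<Longrightarrow> e * e = e \<Longrightarrow> e = 0"
  shows "mathieu_subspace scale \<theta> V"
proof -
  have nil: "\<forall>\<^sub>F m in sequentially. pos_power a m = 0"
    if powers: "\<forall>m\<ge>1. pos_power a m \<in> V" for a
  proof -
    obtain S where S: "finite S" "subalgebra scale hull {a} = span S"
      using finitely_generated_finite_dim[of "{a}"] by (auto simp: finite_dim_def)
    have "pos_power a m \<in> span S" if "m \<ge> 1" for m
      using pos_power_in_subalgebra[OF subalgebra_hull hull_inc that, of a "{a}"] S(2) by simp
    then show ?thesis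
      using nilpotent_if_powers_avoid_idempotents[OF V _ S(1) _ idem] powers by blast
  qed
  have zero: "0 \<in> V"
    using V by (simp add: subspace_0)
  show ?thesis
    unfolding mathieu_subspace_def
  proof (intro conjI allI impI)
    fix a b c
    assume "\<forall>m\<ge>1. pos_power a m \<in> V"
    from nil[OF this] have "\<forall>\<^sub>F m in sequentially. b * pos_power a m \<in> V"
      "\<forall>\<^sub>F m in sequentially. pos_power a m * c \<in> V"
      "\<forall>\<^sub>F m in sequentially. b * pos_power a m * c \<in> V"
      by (auto elim!: eventually_mono simp: zero)
    then show "case \<theta> of
        Left \<Rightarrow> \<forall>\<^sub>F m in sequentially. b * pos_power a m \<in> V
      | Right \<Rightarrow> \<forall>\<^sub>F m in sequentially. pos_power a m * c \<in> V
      | Two_Sided \<Rightarrow> \<forall>\<^sub>F m in sequentially. b * pos_power a m * c \<in> V"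
      by (simp split: side.split)
  qed (fact V)
qed

text \<open>Left multiplication by an idempotent \<open>e\<close> is a projection with range \<open>e * B\<close>, and
  in characteristic zero its trace determines the dimension of \<open>e * B\<close>. If that is
  zero, then \<open>e = e * e\<close> is zero too.\<close>

lemma idempotent_eq_0_if_trace_eq_0:
  assumes B: "subalgebra scale B" "finite_dim scale B"
    and e: "e \<in> B" "e * e = e"
    and trace: "\<And>b. independent b \<Longrightarrow> finite b \<Longrightarrow> span b = B \<Longrightarrow> trace_on b ((*) e) = 0"
  shows "e = 0"
proof -
  interpret L: Vector_Spaces.linear scale scale "(*) e"
    by (rule linear_mult_left)
  obtain S where S: "finite S" "B = span S"
    using B(2) by (auto simp: finite_dim_def)
  have sub: "subspace ((*) e ` B)" "(*) e ` B \<subseteq> B" "subspace B"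
    using B(1) e(1) L.subspace_image by (auto simp: subalgebra_def)
  obtain c where c: "independent c" "finite c" "span c = (*) e ` B"
    using basis_between[OF independent_empty, of "(*) e ` B" S] sub S by auto
  then have "c \<subseteq> B"
    using sub span_superset by blast
  then obtain b where b: "c \<subseteq> b" "independent b" "finite b" "span b = B"
    using basis_between[OF c(1), of B S] sub S by auto
  have "e * x = x" if "x \<in> c" for x
  proof -
    have "x \<in> (*) e ` B"
      using that c(3) span_base by blast
    then obtain y where "x = e * y"
      by blast
    then show ?thesis
      using e(2) by (metis mult.assoc)
  qed
  then have "trace_on b ((*) e) = of_nat (card c)"
    using b c(3) span_superset[of b] by (intro trace_on_projection) auto
  then have "c = {}"
    using trace b c(2) by simp
  then have "(*) e ` B = {0}"
    using c(3) by simp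
  then show ?thesis
    using e by (metis image_eqI singletonD)
qed

section \<open>Images of derivations and E-derivations\<close>

text \<open>The orbit of \<open>a\<close> spans a finite-dimensional \<open>\<delta>\<close>-stable subspace, and a finite spanning
  set of it generates the required subalgebra. The last hypothesis is a
  common consequence of the product rules of derivations and E-derivations; it passes
  stability from the generators to the whole subalgebra.\<close>

lemma stable_finite_dim_subalgebra:
  assumes lin: "Vector_Spaces.linear scale scale \<delta>" and fin: "locally_finite scale \<delta>"
    and product: "\<And>B x y. subalgebra scale B \<Longrightarrow> x \<in> B \<Longrightarrow> y \<in> B \<Longrightarrow> \<delta> x \<in> B \<Longrightarrow> \<delta> y \<in> B
      \<Longrightarrow> \<delta> (x * y) \<in> B"
  obtains B where "subalgebra scale B" "finite_dim scale B" "a \<in> B" "\<delta> ` B \<subseteq> B"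
proof -
  interpret \<delta>: Vector_Spaces.linear scale scale \<delta> by (fact lin)
  define W where "W = span (range (\<lambda>i. (\<delta> ^^ i) a))"
  obtain S where S: "finite S" "W = span S"
    using fin unfolding locally_finite_def finite_dim_def W_def by blast
  define B where "B = subalgebra scale hull S"
  have B: "subalgebra scale B" "S \<subseteq> B"
    unfolding B_def by (rule subalgebra_hull, rule hull_subset)
  then have WB: "W \<subseteq> B"
    unfolding S(2) by (intro span_minimal) (auto simp: subalgebra_def)
  have "\<delta> ((\<delta> ^^ i) a) \<in> W" for i
    unfolding W_def by (rule span_base, rule image_eqI[of _ _ "Suc i"]) auto
  then have "\<delta> ` range (\<lambda>i. (\<delta> ^^ i) a) \<subseteq> W"
    by auto
  then have "\<delta> ` W \<subseteq> W"
    unfolding W_def \<delta>.span_image[symmetric] by (intro span_minimal) auto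
  then have "S \<subseteq> {x \<in> B. \<delta> x \<in> B}"
    using B(2) WB S(2) span_superset[of S] by blast
  moreover have "subalgebra scale {x \<in> B. \<delta> x \<in> B}"
    using B(1) product[OF B(1)]
    by (auto simp: subalgebra_def subspace_def \<delta>.add \<delta>.scale \<delta>.zero)
  ultimately have "B \<subseteq> {x \<in> B. \<delta> x \<in> B}"
    unfolding B_def by (rule hull_minimal)
  moreover have "a \<in> W"
    unfolding W_def by (rule span_base, rule image_eqI[of _ _ 0]) auto
  ultimately show ?thesis
    using that[OF B(1)] WB finitely_generated_finite_dim[OF S(1)] B_def by blast
qed

text \<open>Left multiplication by \<open>D a\<close> is the commutator of \<open>D\<close> with left multiplication
  by \<open>a\<close>, so its trace vanishes on a finite-dimensional \<open>D\<close>-stable subalgebra.\<close>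

lemma derivation_image_no_idempotents:
  assumes D: "derivation scale D" "locally_finite scale D"
    and e: "e \<in> range D" "e * e = e"
  shows "e = 0"
proof -
  obtain a where a: "e = D a"
    using e(1) by blast
  have lin: "Vector_Spaces.linear scale scale D" and prod: "D (x * y) = D x * y + x * D y" for x y
    using D(1) by (auto simp: derivation_def)
  obtain B where B: "subalgebra scale B" "finite_dim scale B" "a \<in> B" "D ` B \<subseteq> B"
    using stable_finite_dim_subalgebra[OF lin D(2), of a] prod
    by (metis subalgebra_def subspace_add)
  have "trace_on b ((*) e) = 0" if b: "independent b" "finite b" "span b = B" for b
  proof -
    have bB: "b \<subseteq> B"
      using b(3) span_superset by blast
    have stable: "(*) a ` b \<subseteq> span b" "D ` b \<subseteq> span b"
      using B bB b(3) by (auto simp: subalgebra_def)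
    have "(*) e = (\<lambda>x. D (a * x) - a * D x)"
      by (auto simp: a prod)
    moreover have "trace_on b (\<lambda>x. D (a * x) - a * D x) =
        trace_on b (\<lambda>x. D (a * x)) - trace_on b (\<lambda>x. a * D x)"
      using B bB b(3) by (intro trace_on_diff b) (auto simp: subalgebra_def image_subset_iff subset_iff)
    ultimately show ?thesis
      using trace_on_commute[OF b(1,2) linear_mult_left stable(1) lin stable(2)] by simp
  qed
  then show ?thesis
    using idempotent_eq_0_if_trace_eq_0[OF B(1,2) _ e(2)] a B(3,4) by blast
qed

text \<open>An injective endomorphism \<open>\<phi>\<close> restricts to an automorphism of any finite-dimensional
  stable subalgebra. Left multiplication by \<open>\<phi> a\<close> is there the conjugate by \<open>\<phi>\<close> of left
  multiplication by \<open>a\<close>, so both have the same trace.\<close>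

lemma E_derivation_image_no_idempotents:
  assumes \<phi>: "algebra_endomorphism scale \<phi>" "inj \<phi>"
    and fin: "locally_finite scale (\<lambda>x. x - \<phi> x)"
    and e: "e \<in> range (\<lambda>x. x - \<phi> x)" "e * e = e"
  shows "e = 0"
proof -
  obtain a where a: "e = a - \<phi> a"
    using e(1) by blast
  have lin: "Vector_Spaces.linear scale scale \<phi>" and prod: "\<phi> (x * y) = \<phi> x * \<phi> y" for x y
    using \<phi>(1) by (auto simp: algebra_endomorphism_def)
  interpret pair: vector_space_pair scale scale by unfold_locales
  have lin_\<delta>: "Vector_Spaces.linear scale scale (\<lambda>x. x - \<phi> x)"
    using pair.linear_compose_sub[OF linear_id[unfolded id_def] lin] .
  have \<phi>_mem: "x - \<phi> x \<in> B \<longleftrightarrow> \<phi> x \<in> B" if "subalgebra scale B" "x \<in> B" for x B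
    using that subspace_diff[of B x "x - \<phi> x"] subspace_diff[of B x "\<phi> x"]
    by (auto simp: subalgebra_def)
  obtain B where B: "subalgebra scale B" "finite_dim scale B" "a \<in> B" "(\<lambda>x. x - \<phi> x) ` B \<subseteq> B"
  proof (rule stable_finite_dim_subalgebra[OF lin_\<delta> fin])
    show "x * y - \<phi> (x * y) \<in> B"
      if "subalgebra scale B" "x \<in> B" "y \<in> B" "x - \<phi> x \<in> B" "y - \<phi> y \<in> B" for B x y
    proof -
      have "x * y \<in> B" "\<phi> x * \<phi> y \<in> B"
        using that \<phi>_mem by (auto simp: subalgebra_def)
      then show ?thesis
        using \<phi>_mem[OF that(1), of "x * y"] prod by simp
    qed
  qed
  have \<phi>B: "\<phi> x \<in> B" if "x \<in> B" for x
    using B(1,4) \<phi>_mem that by blast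
  obtain \<psi> where \<psi>: "Vector_Spaces.linear scale scale \<psi>" "\<psi> \<circ> \<phi> = id"
    using pair.linear_injective_left_inverse[OF lin \<phi>(2)] by blast
  have \<psi>\<phi>: "\<psi> (\<phi> x) = x" for x
    using \<psi>(2) by (metis comp_apply id_apply)
  have lin_a\<psi>: "Vector_Spaces.linear scale scale (\<lambda>x. a * \<psi> x)"
    using Vector_Spaces.linear_compose[OF \<psi>(1) linear_mult_left, of a] by (simp add: o_def)
  have "trace_on b ((*) e) = 0" if b: "independent b" "finite b" "span b = B" for b
  proof -
    have bB: "b \<subseteq> B"
      using b(3) span_superset by blast
    have onto: "\<phi> ` B = B"
      using injective_image_span_eq[OF b(1,2) lin \<phi>(2)] b(3) bB \<phi>B by auto
    have \<phi>\<psi>: "\<psi> x \<in> B" "\<phi> (\<psi> x) = x" if x: "x \<in> B" for x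
    proof -
      obtain y where "y \<in> B" "x = \<phi> y"
        using onto x by blast
      then show "\<psi> x \<in> B" "\<phi> (\<psi> x) = x"
        by (simp_all add: \<psi>\<phi>)
    qed
    have stable: "(\<lambda>x. a * \<psi> x) ` b \<subseteq> span b" "\<phi> ` b \<subseteq> span b"
      using B \<phi>B \<phi>\<psi>(1) bB b(3) by (auto simp: subalgebra_def)
    have "trace_on b ((*) (\<phi> a)) = trace_on b (\<lambda>x. \<phi> (a * \<psi> x))"
      unfolding trace_on_def using \<phi>\<psi>(2) bB by (intro sum.cong) (auto simp: prod subset_iff)
    also have "\<dots> = trace_on b (\<lambda>x. a * \<psi> (\<phi> x))"
      using trace_on_commute[OF b(1,2) lin_a\<psi> stable(1) lin stable(2)] .
    also have "\<dots> = trace_on b ((*) a)"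
      by (simp add: \<psi>\<phi>)
    finally have "trace_on b ((*) a) - trace_on b ((*) (\<phi> a)) = 0"
      by simp
    moreover have "(*) e = (\<lambda>x. a * x - \<phi> a * x)"
      by (auto simp: a left_diff_distrib)
    moreover have "trace_on b (\<lambda>x. a * x - \<phi> a * x) = trace_on b ((*) a) - trace_on b ((*) (\<phi> a))"
      using B \<phi>B bB b(3) by (intro trace_on_diff b) (auto simp: subalgebra_def subset_iff)
    ultimately show ?thesis
      by simp
  qed
  then show ?thesis
    using idempotent_eq_0_if_trace_eq_0[OF B(1,2) _ e(2)] a B(3,4) by blast
qed

lemma locally_nilpotent_imp_locally_finite:
  assumes "Vector_Spaces.linear scale scale \<delta>" "locally_nilpotent \<delta>"
  shows "locally_finite scale \<delta>"
  unfolding locally_finite_def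
proof
  interpret \<delta>: Vector_Spaces.linear scale scale \<delta> by (fact assms(1))
  fix a
  obtain m where m: "(\<delta> ^^ m) a = 0"
    using assms(2) by (auto simp: locally_nilpotent_def)
  have "(\<delta> ^^ i) a = 0" if "i \<ge> m" for i
    using that by (induction i rule: dec_induct) (simp_all add: m \<delta>.zero)
  then have "range (\<lambda>i. (\<delta> ^^ i) a) \<subseteq> insert 0 ((\<lambda>i. (\<delta> ^^ i) a) ` {..<m})"
    by (metis (no_types, lifting) image_eqI image_subsetI insert_iff lessThan_iff not_le)
  then have "finite (range (\<lambda>i. (\<delta> ^^ i) a))"
    by (rule finite_subset) simp
  then show "finite_dim scale (span (range (\<lambda>i. (\<delta> ^^ i) a)))"
    unfolding finite_dim_def by blast
qed

text \<open>On the kernel of \<open>\<phi>\<close> the map \<open>I - \<phi>\<close> is the identity, so local nilpotence forces that kernel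
  to be zero.\<close>

lemma inj_if_locally_nilpotent:
  assumes "Vector_Spaces.linear scale scale \<phi>" "locally_nilpotent (\<lambda>x. x - \<phi> x)"
  shows "inj \<phi>"
proof -
  interpret \<phi>: Vector_Spaces.linear scale scale \<phi> by (fact assms(1))
  have "x = 0" if "\<phi> x = 0" for x
  proof -
    have "((\<lambda>x. x - \<phi> x) ^^ m) x = x" for m
      by (induction m) (simp_all add: that)
    then show ?thesis
      using assms(2) by (metis locally_nilpotent_def)
  qed
  then show ?thesis
    by (simp add: \<phi>.inj_iff_eq_0)
qed

end

theorem corollary1p7:
  fixes scale :: "'k::field_char_0 \<Rightarrow> 'a::ring \<Rightarrow> 'a"
    and \<delta> :: "'a \<Rightarrow> 'a"
  assumes "assoc_algebra scale"
    and "\<And>S. finite S \<Longrightarrow> finite_dim scale (subalgebra scale hull S)"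
    and "derivation scale \<delta> \<or> E_derivation scale \<delta>"
  shows "(locally_nilpotent \<delta> \<longrightarrow>
            (\<forall>V. module.subspace scale V \<longrightarrow> mathieu_subspace scale Two_Sided (\<delta> ` V)) \<and>
            (\<forall>\<theta> J. sided_ideal scale \<theta> J \<longrightarrow> mathieu_subspace scale \<theta> (\<delta> ` J))) \<and>
         (locally_finite scale \<delta> \<and>
            (derivation scale \<delta> \<or>
             (\<exists>\<phi>. algebra_automorphism scale \<phi> \<and> \<delta> = (\<lambda>x. x - \<phi> x))) \<longrightarrow>
            mathieu_subspace scale Two_Sided (range \<delta>))"
proof -
  interpret assoc_algebra scale by (fact assms(1))
  interpret algebra_with_finite_dim_subalgebras scale by unfold_locales (fact assms(2))
  have lin: "Vector_Spaces.linear scale scale \<delta>"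
    using assms(3) by (auto simp: derivation_def E_derivation_def)
  interpret \<delta>: Vector_Spaces.linear scale scale \<delta> by (fact lin)
  have mathieu: "mathieu_subspace scale \<theta> (\<delta> ` V)"
    if "\<And>e. e \<in> range \<delta> \<Longrightarrow> e * e = e \<Longrightarrow> e = 0" "subspace V" for \<theta> V
    using that by (intro mathieu_if_no_idempotents \<delta>.subspace_image) auto
  have nilpotent: "e = 0" if "locally_nilpotent \<delta>" "e \<in> range \<delta>" "e * e = e" for e
    using assms(3)
  proof
    assume "derivation scale \<delta>"
    then show ?thesis
      using derivation_image_no_idempotents locally_nilpotent_imp_locally_finite[OF lin] that
      by blast
  next
    assume "E_derivation scale \<delta>"
    then obtain \<phi> where "algebra_endomorphism scale \<phi>" "\<delta> = (\<lambda>x. x - \<phi> x)"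
      using E_derivation_iff by blast
    then show ?thesis
      using E_derivation_image_no_idempotents inj_if_locally_nilpotent
        locally_nilpotent_imp_locally_finite[OF lin] that
      by (metis algebra_endomorphism_def)
  qed
  have finite: "e = 0"
    if "locally_finite scale \<delta>" "e \<in> range \<delta>" "e * e = e" and
      "derivation scale \<delta> \<or> (\<exists>\<phi>. algebra_automorphism scale \<phi> \<and> \<delta> = (\<lambda>x. x - \<phi> x))" for e
    using that derivation_image_no_idempotents E_derivation_image_no_idempotents
    by (metis algebra_automorphism_def bij_is_inj)
  show ?thesis
    using mathieu nilpotent finite subspace_UNIV by (auto simp: sided_ideal_def)
qed

end
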